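(* Let $k\ge 1$, let $n_1,\dots,n_k$ be positive integers and let $a_1,\dots,a_k$ be integers. The additive subgroup generated by the element $(a_1,a_2,\dots,a_k)$ in the ring $\mathbb{Z}_{n_1}\times\mathbb{Z}_{n_2}\times\cdots\times\mathbb{Z}_{n_k}$ is an ideal if and only if \[\prod_{1\le i<j\le k}\gcd\left(\frac{n_i}{\gcd(a_i,n_i)},\frac{n_j}{\gcd(a_j,n_j)}\right)=1.\]
   Context: $\mathbb{Z}_N$ is the ring of integers modulo $N$; product rings have componentwise operations. Each integer $a_i$ is identified with its residue class in $\mathbb{Z}_{n_i}$. *)

theory Defs
  imports "HOL-Algebra.Generated_Groups" "HOL-Algebra.Chinese_Remainder" "HOL-Algebra.IntRing"
begin

(* Z_N is ZFact N rather than residue_ring N, whose unit for N = 1 lies outside its carrier. *)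

definition residue_class :: "int \<Rightarrow> int \<Rightarrow> int set" where
  "residue_class N a = (Idl\<^bsub>\<Z>\<^esub> {N}) +>\<^bsub>\<Z>\<^esub> a"

(* RDirProd_list is indexed from 0, so position i - 1 holds the i-th factor, 1 <= i <= k. *)

definition ZFact_prod :: "nat \<Rightarrow> (nat \<Rightarrow> int) \<Rightarrow> int set list ring" where
  "ZFact_prod k n = RDirProd_list (map (\<lambda>i. ZFact (n i)) [1..<Suc k])"

definition residue_tuple :: "nat \<Rightarrow> (nat \<Rightarrow> int) \<Rightarrow> (nat \<Rightarrow> int) \<Rightarrow> int set list" where
  "residue_tuple k n a = map (\<lambda>i. residue_class (n i) (a i)) [1..<Suc k]"

lemma ring_ZFact_prod: "ring (ZFact_prod k n)"
  unfolding ZFact_prod_def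
  by (rule RDirProd_list_is_ring)
     (simp del: upt_Suc add: ZFact_is_cring[unfolded cring_def, THEN conjunct1])

lemma residue_class_carrier: "residue_class N a \<in> carrier (ZFact N)"
  by (auto simp: residue_class_def ZFact_def FactRing_def A_RCOSETS_def')

lemma residue_tuple_carrier: "residue_tuple k n a \<in> carrier (ZFact_prod k n)"
  unfolding ZFact_prod_def residue_tuple_def
  by (rule RDirProd_list_carrier_memI) (simp_all del: upt_Suc add: residue_class_carrier)

end

theory Submission
  imports Defs "HOL-Algebra.Elementary_Groups" "HOL-Number_Theory.Cong"
begin

text \<open>
  Put \<open>d i = n i div gcd (a i) (n i)\<close>, the additive order of \<open>a i\<close> modulo \<open>n i\<close>. Multiplication by
  \<open>a i\<close> on \<open>\<int>\<close> induces an injection of \<open>\<int>\<close> modulo \<open>d i\<close> into \<open>\<int>\<close> modulo \<open>n i\<close>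
  (\<open>cong_mult_right_iff_cong_div_gcd\<close>).

  The subgroup generated by the tuple of the \<open>a i\<close> consists of the tuples of the \<open>m * a i\<close>, for a
  single integer \<open>m\<close>. It is already closed under addition, and multiplying such a tuple by a ring
  element only replaces the tuple of the \<open>a i\<close> by the tuple of some \<open>x i * a i\<close>. Hence it is an ideal
  iff for every family \<open>x\<close> there is one \<open>m\<close> with \<open>m * a i \<equiv> x i * a i\<close> modulo every \<open>n i\<close>, that is,
  with \<open>m \<equiv> x i\<close> modulo every \<open>d i\<close> (\<open>ideal_generate_residue_tuple_iff\<close>).

  So the subgroup is an ideal iff every system of simultaneous congruences with the moduli \<open>d i\<close> is
  solvable, and that is the case iff the \<open>d i\<close> are pairwise coprime
  (\<open>all_cong_systems_solvable_iff_coprime\<close>). Finally, a product of gcds, which are nonnegative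
  integers, equals 1 iff every factor does.
\<close>

section \<open>Simultaneous congruences\<close>

text \<open>
  Cancelling \<open>gcd a n\<close> from both \<open>a\<close> and \<open>n\<close> leaves a factor \<open>a div gcd a n\<close> that is coprime to the
  new modulus and can therefore be cancelled too.
\<close>

lemma cong_mult_right_iff_cong_div_gcd:
  fixes a n x y :: int
  assumes "n \<noteq> 0"
  shows "[x * a = y * a] (mod n) \<longleftrightarrow> [x = y] (mod (n div gcd a n))"
proof -
  define g where "g = gcd a n"
  have g: "g \<noteq> 0" using assms by (simp add: g_def)
  have a: "a = g * (a div g)" and n: "n = g * (n div g)"
    by (simp_all add: g_def)
  have cop: "coprime (n div g) (a div g)"
    using assms unfolding g_def by (metis coprime_commute div_gcd_coprime)
  have "n dvd (x - y) * a \<longleftrightarrow> g * (n div g) dvd g * ((x - y) * (a div g))"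
    using a n by (metis mult.left_commute)
  also have "\<dots> \<longleftrightarrow> n div g dvd x - y"
    using g cop by (simp add: coprime_dvd_mult_left_iff)
  finally show ?thesis
    by (simp add: cong_iff_dvd_diff g_def left_diff_distrib)
qed

lemma chinese_remainder_int:
  fixes d x :: "'a \<Rightarrow> int"
  assumes "finite A"
    and pos: "\<And>i. i \<in> A \<Longrightarrow> d i > 0"
    and cop: "\<And>i j. i \<in> A \<Longrightarrow> j \<in> A \<Longrightarrow> i \<noteq> j \<Longrightarrow> coprime (d i) (d j)"
  shows "\<exists>m. \<forall>i\<in>A. [m = x i] (mod d i)"
proof -
  have "\<exists>y. \<forall>i\<in>A. [y = nat (x i mod d i)] (mod nat (d i))"
    using \<open>finite A\<close>
  proof (rule chinese_remainder_nat)
    show "\<forall>i\<in>A. \<forall>j\<in>A. i \<noteq> j \<longrightarrow> coprime (nat (d i)) (nat (d j))"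
      using cop pos by (metis coprime_int_iff less_imp_le nat_0_le)
  qed
  then obtain y where y: "\<And>i. i \<in> A \<Longrightarrow> [y = nat (x i mod d i)] (mod nat (d i))"
    by blast
  have "[int y = x i] (mod d i)" if "i \<in> A" for i
  proof -
    have "[int y = int (nat (x i mod d i))] (mod int (nat (d i)))"
      using y[OF that] by (simp only: cong_int_iff)
    then show ?thesis
      using pos[OF that] by (simp add: cong_def)
  qed
  then show ?thesis by blast
qed

text \<open>
  The converse of the Chinese remainder theorem is elementary: a solution of the system that asks for
  1 modulo \<open>d j\<close> and for 0 modulo the other moduli is a multiple of \<open>d i\<close>, so every common divisor
  of \<open>d i\<close> and \<open>d j\<close> divides 1.
\<close>

lemma all_cong_systems_solvable_iff_coprime:
  fixes d :: "'a \<Rightarrow> int"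
  assumes "finite A" and "\<And>i. i \<in> A \<Longrightarrow> d i > 0"
  shows "(\<forall>x. \<exists>m. \<forall>i\<in>A. [m = x i] (mod d i)) \<longleftrightarrow>
    (\<forall>i\<in>A. \<forall>j\<in>A. i \<noteq> j \<longrightarrow> coprime (d i) (d j))"
proof (intro iffI ballI impI)
  fix i j assume solvable: "\<forall>x. \<exists>m. \<forall>i\<in>A. [m = x i] (mod d i)"
    and ij: "i \<in> A" "j \<in> A" "i \<noteq> j"
  obtain m where m: "\<And>l. l \<in> A \<Longrightarrow> [m = (if l = j then 1 else 0)] (mod d l)"
    using solvable[rule_format, of "\<lambda>l. if l = j then 1 else 0"] by blast
  have "d i dvd m" using m[OF ij(1)] ij(3) by (simp add: cong_0_iff)
  moreover have "d j dvd m - 1" using m[OF ij(2)] by (simp add: cong_iff_dvd_diff)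
  ultimately show "coprime (d i) (d j)"
  proof (intro coprimeI)
    fix c assume "d i dvd m" "d j dvd m - 1" "c dvd d i" "c dvd d j"
    then have "c dvd m - (m - 1)" by (meson dvd_diff dvd_trans)
    then show "is_unit c" by simp
  qed
next
  assume "\<forall>i\<in>A. \<forall>j\<in>A. i \<noteq> j \<longrightarrow> coprime (d i) (d j)"
  then show "\<forall>x. \<exists>m. \<forall>i\<in>A. [m = x i] (mod d i)"
    by (intro allI chinese_remainder_int) (use assms in auto)
qed

lemma prod_gcd_eq_1_iff:
  fixes f :: "'a \<Rightarrow> int" and g :: "'a \<Rightarrow> int"
  assumes "finite A"
  shows "(\<Prod>x\<in>A. gcd (f x) (g x)) = 1 \<longleftrightarrow> (\<forall>x\<in>A. coprime (f x) (g x))"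
proof
  assume "(\<Prod>x\<in>A. gcd (f x) (g x)) = 1"
  then have "gcd (f x) (g x) dvd 1" if "x \<in> A" for x
    using dvd_prodI[OF assms that, of "\<lambda>x. gcd (f x) (g x)"] by simp
  then show "\<forall>x\<in>A. coprime (f x) (g x)"
    by (simp add: coprime_iff_gcd_eq_1)
qed (simp add: coprime_iff_gcd_eq_1)

section \<open>The product ring in coordinates\<close>

text \<open>
  The product ring is built by transporting the structure of a binary product along the bijection
  that sends a pair \<open>(x, xs)\<close> to \<open>x # xs\<close>; that this bijection is a homomorphism makes the operations
  componentwise, one factor at a time.
\<close>

lemma RDirProd_list_map_ops:
  assumes "\<And>i. i \<in> set is \<Longrightarrow> f i \<in> carrier (R i)" and "\<And>i. i \<in> set is \<Longrightarrow> g i \<in> carrier (R i)"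
  shows "map f is \<otimes>\<^bsub>RDirProd_list (map R is)\<^esub> map g is = map (\<lambda>i. f i \<otimes>\<^bsub>R i\<^esub> g i) is"
    and "map f is \<oplus>\<^bsub>RDirProd_list (map R is)\<^esub> map g is = map (\<lambda>i. f i \<oplus>\<^bsub>R i\<^esub> g i) is"
proof -
  have "map f is \<otimes>\<^bsub>RDirProd_list (map R is)\<^esub> map g is = map (\<lambda>i. f i \<otimes>\<^bsub>R i\<^esub> g i) is \<and>
    map f is \<oplus>\<^bsub>RDirProd_list (map R is)\<^esub> map g is = map (\<lambda>i. f i \<oplus>\<^bsub>R i\<^esub> g i) is"
    using assms
  proof (induction "is")
    case Nil
    then show ?case by (simp add: monoid.defs)
  next
    case (Cons i "is")
    let ?S = "RDirProd_list (map R is)"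
    have "map h is \<in> carrier ?S" if "\<And>j. j \<in> set is \<Longrightarrow> h j \<in> carrier (R j)" for h
      using that by (intro RDirProd_list_carrier_memI) simp_all
    then have "(f i, map f is) \<in> carrier (RDirProd (R i) ?S)"
      "(g i, map g is) \<in> carrier (RDirProd (R i) ?S)"
      using Cons.prems by (simp_all add: RDirProd_carrier)
    note ops = ring_hom_memE(2,3)[OF RDirProd_list_hom1 this]
    then show ?case
      using Cons by (simp add: RDirProd_def DirProd_def monoid.defs)
  qed
  then show "map f is \<otimes>\<^bsub>RDirProd_list (map R is)\<^esub> map g is = map (\<lambda>i. f i \<otimes>\<^bsub>R i\<^esub> g i) is"
    and "map f is \<oplus>\<^bsub>RDirProd_list (map R is)\<^esub> map g is = map (\<lambda>i. f i \<oplus>\<^bsub>R i\<^esub> g i) is"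
    by auto
qed

lemma residue_class_eq_iff: "residue_class N x = residue_class N y \<longleftrightarrow> [x = y] (mod N)"
  using ZMod_eq_mod[of N x y] by (simp add: residue_class_def ZMod_def cong_def)

lemma residue_class_ring_hom: "residue_class N \<in> ring_hom \<Z> (ZFact N)"
proof -
  interpret ideal "Idl\<^bsub>\<Z>\<^esub> {N}" \<Z>
    by (rule int.genideal_ideal) simp
  have "residue_class N = (+>\<^bsub>\<Z>\<^esub>) (Idl\<^bsub>\<Z>\<^esub> {N})"
    by (simp add: residue_class_def fun_eq_iff)
  then show ?thesis
    using rcos_ring_hom by (simp add: ZFact_def)
qed

lemma carrier_ZFact: "carrier (ZFact N) = range (residue_class N)"
  by (auto simp: residue_class_def ZFact_def FactRing_def A_RCOSETS_def')

lemma residue_tuple_mult: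
  "residue_tuple k n x \<otimes>\<^bsub>ZFact_prod k n\<^esub> residue_tuple k n y = residue_tuple k n (\<lambda>i. x i * y i)"
  using ring_hom_memE(2)[OF residue_class_ring_hom]
  unfolding residue_tuple_def ZFact_prod_def
  by (simp del: upt_Suc add: RDirProd_list_map_ops residue_class_carrier)

lemma residue_tuple_add:
  "residue_tuple k n x \<oplus>\<^bsub>ZFact_prod k n\<^esub> residue_tuple k n y = residue_tuple k n (\<lambda>i. x i + y i)"
  using ring_hom_memE(3)[OF residue_class_ring_hom]
  unfolding residue_tuple_def ZFact_prod_def
  by (simp del: upt_Suc add: RDirProd_list_map_ops residue_class_carrier)

lemma residue_tuple_eq_iff:
  "residue_tuple k n x = residue_tuple k n y \<longleftrightarrow> (\<forall>i\<in>{1..k}. [x i = y i] (mod n i))"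
  by (auto simp del: upt_Suc simp add: residue_tuple_def residue_class_eq_iff)

lemma carrier_ZFact_prod: "carrier (ZFact_prod k n) = range (residue_tuple k n)"
proof (intro equalityI subsetI)
  fix r assume "r \<in> carrier (ZFact_prod k n)"
  note r = RDirProd_list_carrier_mem[OF this[unfolded ZFact_prod_def]]
  have len: "length r = k"
    using r(1) by (simp del: upt_Suc)
  have mem: "r ! i \<in> range (residue_class (n (Suc i)))" if "i < k" for i
    using r(2)[of i] that by (simp del: upt_Suc add: carrier_ZFact)
  \<comment> \<open>List positions start at 0 while the factors are numbered from 1.\<close>
  define x where "x i = (SOME z. r ! (i - 1) = residue_class (n i) z)" for i
  have "r ! i = residue_class (n (Suc i)) (x (Suc i))" if "i < k" for i
    using someI_ex[of "\<lambda>z. r ! i = residue_class (n (Suc i)) z"] mem[OF that]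
    by (auto simp: x_def)
  then have "r = residue_tuple k n x"
    using len by (intro nth_equalityI) (simp_all del: upt_Suc add: residue_tuple_def)
  then show "r \<in> range (residue_tuple k n)" by blast
qed (auto intro: residue_tuple_carrier)

section \<open>When the generated subgroup is an ideal\<close>

text \<open>
  The map from \<open>m\<close> to the tuple of the \<open>m * a i\<close> is a homomorphism from the additive group of the
  integers, so it carries the subgroup generated by 1, which is everything, onto the subgroup
  generated by the image of 1.
\<close>

lemma generate_residue_tuple:
  "generate (add_monoid (ZFact_prod k n)) {residue_tuple k n a}
    = range (\<lambda>m. residue_tuple k n (\<lambda>i. m * a i))"
proof -
  define h where "h m = residue_tuple k n (\<lambda>i. m * a i)" for m
  interpret R: ring "ZFact_prod k n" by (rule ring_ZFact_prod)
  interpret group_hom integer_group "add_monoid (ZFact_prod k n)" h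
    using R.a_group
    by (simp add: group_hom_def group_hom_axioms_def hom_def h_def
        residue_tuple_carrier residue_tuple_add distrib_right)
  have "generate integer_group {1} = UNIV"
    using G.generate_pow[of 1] by simp
  then have "generate (add_monoid (ZFact_prod k n)) {h 1} = range h"
    using generate_img[of "{1}"] by simp
  then show ?thesis
    by (simp add: h_def[abs_def])
qed

text \<open>
  Every ring element is the tuple of some integers \<open>x i\<close>, so the condition says that the generated
  subgroup contains all ring multiples of its generator. This suffices for an ideal, because the
  product of a ring element with \<open>m\<close> times the generator is again a ring multiple of the generator.
\<close>

lemma ideal_generate_residue_tuple_iff:
  "ideal (generate (add_monoid (ZFact_prod k n)) {residue_tuple k n a}) (ZFact_prod k n)
    \<longleftrightarrow> (\<forall>x. \<exists>m. \<forall>i\<in>{1..k}. [m * a i = x i * a i] (mod n i))"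
proof -
  let ?R = "ZFact_prod k n" and ?t = "residue_tuple k n"
  let ?I = "generate (add_monoid ?R) {?t a}"
  interpret R: ring ?R by (rule ring_ZFact_prod)
  have in_I: "?t y \<in> ?I \<longleftrightarrow> (\<exists>m. \<forall>i\<in>{1..k}. [m * a i = y i] (mod n i))" for y
    unfolding generate_residue_tuple image_iff
    using residue_tuple_eq_iff[of k n] by (auto simp: cong_sym_eq)
  have "ideal ?I ?R \<longleftrightarrow> (\<forall>x. ?t (\<lambda>i. x i * a i) \<in> ?I)"
  proof
    assume "ideal ?I ?R"
    moreover have "?t a \<in> ?I" by (simp add: generate.incl)
    ultimately show "\<forall>x. ?t (\<lambda>i. x i * a i) \<in> ?I"
      using ideal.I_l_closed residue_tuple_carrier residue_tuple_mult by metis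
  next
    assume closed: "\<forall>x. ?t (\<lambda>i. x i * a i) \<in> ?I"
    show "ideal ?I ?R"
    proof (rule idealI)
      show "subgroup ?I (add_monoid ?R)"
        by (intro R.add.generate_is_subgroup) (simp add: residue_tuple_carrier)
    next
      fix s r assume "s \<in> ?I" "r \<in> carrier ?R"
      obtain m where "s = ?t (\<lambda>i. m * a i)"
        using \<open>s \<in> ?I\<close> unfolding generate_residue_tuple by blast
      moreover obtain y where "r = ?t y"
        using \<open>r \<in> carrier ?R\<close> unfolding carrier_ZFact_prod by blast
      ultimately have "r \<otimes>\<^bsub>?R\<^esub> s = ?t (\<lambda>i. (m * y i) * a i)" "s \<otimes>\<^bsub>?R\<^esub> r = ?t (\<lambda>i. (m * y i) * a i)"
        by (simp_all add: residue_tuple_mult ac_simps)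
      then show "r \<otimes>\<^bsub>?R\<^esub> s \<in> ?I" "s \<otimes>\<^bsub>?R\<^esub> r \<in> ?I"
        using closed[rule_format, of "\<lambda>i. m * y i"] by simp_all
    qed (rule R.ring_axioms)
  qed
  then show ?thesis by (simp only: in_I)
qed

theorem theorem4p3:
  fixes k :: nat and n a :: "nat \<Rightarrow> int"
  assumes "k \<ge> 1"
    and "\<And>i. i \<in> {1..k} \<Longrightarrow> n i > 0"
  shows "ideal (generate (add_monoid (ZFact_prod k n)) {residue_tuple k n a}) (ZFact_prod k n)
    \<longleftrightarrow> (\<Prod>(i, j) \<in> {(i, j). 1 \<le> i \<and> i < j \<and> j \<le> k}.
          gcd (n i div gcd (a i) (n i)) (n j div gcd (a j) (n j))) = 1"
proof -
  let ?d = "\<lambda>i. n i div gcd (a i) (n i)" and ?P = "{(i, j). 1 \<le> i \<and> i < j \<and> j \<le> k}"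
  have pos: "?d i > 0" if "i \<in> {1..k}" for i
    using assms(2)[OF that] by (simp add: pos_imp_zdiv_pos_iff zdvd_imp_le)
  have "finite ?P"
    by (rule finite_subset[of _ "{..k} \<times> {..k}"]) auto
  have "ideal (generate (add_monoid (ZFact_prod k n)) {residue_tuple k n a}) (ZFact_prod k n)
    \<longleftrightarrow> (\<forall>x. \<exists>m. \<forall>i\<in>{1..k}. [m * a i = x i * a i] (mod n i))"
    by (rule ideal_generate_residue_tuple_iff)
  also have "\<dots> \<longleftrightarrow> (\<forall>x. \<exists>m. \<forall>i\<in>{1..k}. [m = x i] (mod ?d i))"
  proof -
    have "[m * a i = x i * a i] (mod n i) \<longleftrightarrow> [m = x i] (mod ?d i)" if "i \<in> {1..k}" for m x i
      using assms(2)[OF that] by (intro cong_mult_right_iff_cong_div_gcd) simp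
    then show ?thesis by (metis (mono_tags, lifting))
  qed
  also have "\<dots> \<longleftrightarrow> (\<forall>i\<in>{1..k}. \<forall>j\<in>{1..k}. i \<noteq> j \<longrightarrow> coprime (?d i) (?d j))"
    using pos by (intro all_cong_systems_solvable_iff_coprime) simp_all
  also have "\<dots> \<longleftrightarrow> (\<forall>p\<in>?P. coprime (?d (fst p)) (?d (snd p)))"
  proof (intro iffI ballI impI)
    fix i j assume *: "\<forall>p\<in>?P. coprime (?d (fst p)) (?d (snd p))"
      and ij: "i \<in> {1..k}" "j \<in> {1..k}" "i \<noteq> j"
    consider "i < j" | "j < i" using ij(3) by linarith
    then show "coprime (?d i) (?d j)"
    proof cases
      case 1
      then show ?thesis using *[rule_format, of "(i, j)"] ij by simp
    next
      case 2
      then show ?thesis using *[rule_format, of "(j, i)"] ij by (simp add: coprime_commute)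
    qed
  qed auto
  also have "\<dots> \<longleftrightarrow> (\<Prod>p\<in>?P. gcd (?d (fst p)) (?d (snd p))) = 1"
    using \<open>finite ?P\<close> by (rule prod_gcd_eq_1_iff[symmetric])
  finally show ?thesis
    by (simp add: case_prod_unfold)
qed

end
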